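(* There is an absolute constant $C>0$ such that for all $d,k,n\in\mathbb{N}$ with $2k\le n$ and $k>d^2$, $$\delta(n,k,\mathrm{AP}(d))\le \frac{C}{\log(k/d^2)}.$$
   Context: A pattern of order $t$ is an element $P\in\{+,-\}^t$. For $A,B\subset[n]$ write $\mathrm{pat}(A,B)=P$ if $A\triangle B=\{j_1,\dots,j_t\}$ with $j_1<\dots<j_t$, $P$ has order $t$, and $\{i\in[t]:P_i=+\}=\{i\in[t]: j_i\in A\setminus B\}$. A family $\mathcal{A}$ of subsets of $[n]$ is $P$-free if $\mathrm{pat}(A,B)\neq P$ for all $A,B\in\mathcal{A}$. $\delta(n,k,P)$ denotes the maximum size of a $P$-free family $\mathcal{A}\subset\binom{[n]}{k}$ divided by $\binom{n}{k}$. The alternating pattern $\mathrm{AP}(d)\in\{+,-\}^{2d}$ is $+-+-\cdots+-$ ($d$ copies of $+-$). *)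

theory Defs
  imports Complex_Main "HOL-Library.Ramsey"
begin

datatype sign = Plus | Minus

type_synonym pattern = "sign list"

definition pat :: "nat set \<Rightarrow> nat set \<Rightarrow> pattern" where
  "pat A B = map (\<lambda>j. if j \<in> A - B then Plus else Minus) (sorted_list_of_set (sym_diff A B))"

lemma pat_eq_iff:
  assumes "finite A" "finite B"
  defines "js \<equiv> sorted_list_of_set (sym_diff A B)"
  shows "pat A B = P \<longleftrightarrow>
    length P = card (sym_diff A B) \<and>
    {i. i < length P \<and> P ! i = Plus} = {i. i < length P \<and> js ! i \<in> A - B}"
proof -
  have len: "length js = card (sym_diff A B)"
    by (simp add: js_def)
  have eq: "pat A B = map (\<lambda>j. if j \<in> A - B then Plus else Minus) js"
    by (simp add: pat_def js_def)
  show ?thesis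
    unfolding eq list_eq_iff_nth_eq length_map len set_eq_iff mem_Collect_eq
    by (smt (verit) len nth_map sign.distinct(1) sign.exhaust)
qed

(* The members A and B are not required to be distinct and both orders occur,
   so a family is free of P iff it is free of the sign-reversed pattern. *)
definition pattern_free :: "pattern \<Rightarrow> nat set set \<Rightarrow> bool" where
  "pattern_free P \<A> \<longleftrightarrow> (\<forall>A\<in>\<A>. \<forall>B\<in>\<A>. pat A B \<noteq> P)"

(* The ground set [n] is {1..n}, and nsets {1..n} k is the family of its k-subsets.
   The maximum is over a finite set that contains 0 (from the empty family). *)
definition pattern_density :: "nat \<Rightarrow> nat \<Rightarrow> pattern \<Rightarrow> real" where
  "pattern_density n k P =
     real (Max {card \<A> | \<A>. \<A> \<subseteq> nsets {1..n} k \<and> pattern_free P \<A>}) / real (n choose k)"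

definition AP :: "nat \<Rightarrow> pattern" where
  "AP d = concat (replicate d [Plus, Minus])"

end

(* Average over the 2k-subsets of {1..n} to reduce to n = 2k, and cut {0..<2k} into
   consecutive blocks of length m, where m is about ln (k/d^2) / 2. Call a block good for A
   if A meets it in exactly one point. Fixing the good blocks and the rest of A, what remains
   is a word in [m]^N, N being the number of good blocks, and changing the letter i to i' in
   exactly d places produces the pattern AP(d). In an AP(d)-free family of words, a pair (w, D)
   with w constant on the d-set D is therefore determined by D and w off D; as a word has, by
   convexity, many such D once N >= m d^2, the family has density at most 2/m. The sets A with
   fewer good blocks have density at most 8/m by Chebyshev's inequality. *)
theory Submission
  imports Defs "HOL-Library.FuncSet"
begin

text \<open>The saving \<open>1/m\<close> is the freedom lost on \<open>D\<close>: a pair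
  \<open>(w, D)\<close> would have \<open>m\<close> letters to choose from there, but freeness
  leaves one. Convexity finds enough sets \<open>D\<close> only if the average letter class, of size
  \<open>N/m\<close>, is large compared with \<open>d\<close> falling-factorial steps. The relative
  loss is at most the sum of \<open>j * m / N\<close> over \<open>j < d\<close>, and
  \<open>m * d^2 <= N\<close> keeps it below one half. This is the origin of \<open>d^2\<close>. The
  logarithm comes from demanding exactly one point per block. After the reduction to ground size
  \<open>2 * k\<close>, a point lies in \<open>A\<close> with probability 1/2, so a block is good
  with probability about \<open>m / 2^m\<close>; the proof uses the lower bound
  \<open>m / 3^m\<close>. Half the expected number of good blocks must still reach
  \<open>m * d^2\<close>, which leads to \<open>2 * m * 3^m * d^2 <= k\<close> and so to
  \<open>m\<close> of order \<open>ln (k / d^2)\<close>. The obstacle is that blocks are not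
  independent in a uniform \<open>k\<close>-set. Chebyshev's inequality needs only pairs, and two
  blocks are correlated by at most a factor \<open>1 + 1/m\<close>.\<close>

subsection \<open>Families of words\<close>

text \<open>The double sum of \<open>(a i - a j) * (b i - b j)\<close> has nonnegative terms and
  expands to twice the difference of the two sides. Comparing pairs avoids any order on
  \<open>I\<close>.\<close>

lemma Chebyshev_sum_pairwise:
  fixes a b :: "'a \<Rightarrow> real"
  assumes "\<And>i j. i \<in> I \<Longrightarrow> j \<in> I \<Longrightarrow> (a i - a j) * (b i - b j) \<ge> 0"
  shows "(\<Sum>i\<in>I. a i) * (\<Sum>i\<in>I. b i) \<le> real (card I) * (\<Sum>i\<in>I. a i * b i)"
proof -
  have "0 \<le> (\<Sum>i\<in>I. \<Sum>j\<in>I. (a i - a j) * (b i - b j))"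
    by (intro sum_nonneg assms)
  also have "\<dots> = (\<Sum>i\<in>I. \<Sum>j\<in>I. a i * b i) + (\<Sum>i\<in>I. \<Sum>j\<in>I. a j * b j)
      - (\<Sum>i\<in>I. \<Sum>j\<in>I. a i * b j) - (\<Sum>i\<in>I. \<Sum>j\<in>I. a j * b i)"
    by (simp add: algebra_simps sum.distrib sum_subtractf)
  also have "(\<Sum>i\<in>I. \<Sum>j\<in>I. a j * b i) = (\<Sum>i\<in>I. \<Sum>j\<in>I. a i * b j)"
    by (rule sum.swap)
  also have "(\<Sum>i\<in>I. \<Sum>j\<in>I. a i * b j) = (\<Sum>i\<in>I. a i) * (\<Sum>i\<in>I. b i)"
    by (simp add: sum_product)
  also have "(\<Sum>i\<in>I. \<Sum>j\<in>I. a i * b i) = card I * (\<Sum>i\<in>I. a i * b i)"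
    by (simp add: sum_distrib_left)
  also have "(\<Sum>i\<in>I. \<Sum>j\<in>I. a j * b j) = card I * (\<Sum>i\<in>I. a i * b i)"
    by simp
  finally show ?thesis by linarith
qed

text \<open>Jensen's inequality for falling factorials, by induction on \<open>d\<close> instead of
  convexity: the new factor \<open>n i - d\<close> is ordered like the product so far, so
  Chebyshev's sum inequality splits it off. The hypothesis makes the average at least
  \<open>d - 1\<close>, so that every factor on the left is nonnegative.\<close>

lemma sum_falling_factorial_ge:
  fixes n :: "'a \<Rightarrow> nat"
  assumes "finite I" "I \<noteq> {}" "(d - 1) * card I \<le> (\<Sum>i\<in>I. n i)"
  shows "real (card I) * (\<Prod>j<d. (\<Sum>i\<in>I. real (n i)) / card I - real j)
    \<le> (\<Sum>i\<in>I. \<Prod>j<d. real (n i) - real j)"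
  using assms(3)
proof (induction d)
  case (Suc d)
  define q where "q = (\<Sum>i\<in>I. real (n i)) / card I"
  have I: "card I > 0" using assms by (simp add: card_gt_0_iff)
  \<comment> \<open>At natural arguments the falling factorial is a multiple of a binomial
    coefficient, hence monotone; at real arguments it need not be.\<close>
  have ff: "(\<Prod>j<d. real x - real j) = real (x choose d) * fact d" for x
    by (simp add: binomial_gbinomial gbinomial_prod_rev atLeast0LessThan)
  have "(d - 1) * card I \<le> d * card I" by (intro mult_right_mono) auto
  also have dI: "\<dots> \<le> (\<Sum>i\<in>I. n i)" using Suc.prems by simp
  finally have IH: "real (card I) * (\<Prod>j<d. q - real j) \<le> (\<Sum>i\<in>I. \<Prod>j<d. real (n i) - real j)"
    using Suc.IH by (simp add: q_def)
  have "real (d * card I) \<le> real (\<Sum>i\<in>I. n i)" using dI of_nat_le_iff by blast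
  then have q: "q - real d \<ge> 0"
    using I by (simp add: q_def field_simps)
  have mono: "((\<Prod>j<d. real x - real j) - (\<Prod>j<d. real y - real j))
      * ((real x - real d) - (real y - real d)) \<ge> 0" for x y :: nat
  proof -
    have "x choose d \<le> y choose d" if "x \<le> y" for x y :: nat
      using that by (rule binomial_right_mono)
    then show ?thesis unfolding ff
      by (cases "x \<le> y") (auto intro!: mult_nonneg_nonneg mult_nonpos_nonpos mult_right_mono)
  qed
  have "(\<Sum>i\<in>I. real (n i) - real d) = card I * (q - real d)"
    using I by (simp add: q_def sum_subtractf field_simps)
  then have "(\<Sum>i\<in>I. \<Prod>j<d. real (n i) - real j) * (card I * (q - real d))
     \<le> card I * (\<Sum>i\<in>I. \<Prod>j<Suc d. real (n i) - real j)"
    using Chebyshev_sum_pairwise[of I "\<lambda>i. \<Prod>j<d. real (n i) - real j" "\<lambda>i. real (n i) - real d"] mono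
    by simp
  then have "(\<Sum>i\<in>I. \<Prod>j<d. real (n i) - real j) * (q - real d)
     \<le> (\<Sum>i\<in>I. \<Prod>j<Suc d. real (n i) - real j)"
    using I by (simp add: mult.left_commute)
  moreover have "real (card I) * (\<Prod>j<d. q - real j) * (q - real d)
      \<le> (\<Sum>i\<in>I. \<Prod>j<d. real (n i) - real j) * (q - real d)"
    using IH q by (rule mult_right_mono)
  ultimately show ?case
    by (simp add: q_def mult.assoc)
qed simp

text \<open>The Weierstrass product inequality.\<close>

lemma prod_one_minus_ge:
  fixes x :: "nat \<Rightarrow> real"
  assumes "\<And>j. j < d \<Longrightarrow> 0 \<le> x j \<and> x j \<le> 1"
  shows "1 - (\<Sum>j<d. x j) \<le> (\<Prod>j<d. 1 - x j)"
  using assms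
proof (induction d)
  case (Suc d)
  have "(\<Prod>j<d. 1 - x j) \<le> 1" "0 \<le> (\<Prod>j<d. 1 - x j)"
    using Suc.prems by (auto intro!: prod_le_1 prod_nonneg simp: less_Suc_eq)
  moreover have "0 \<le> x d" "x d \<le> 1" using Suc.prems by auto
  moreover have "1 - (\<Sum>j<d. x j) \<le> (\<Prod>j<d. 1 - x j)" using Suc by simp
  ultimately have "x d * (\<Prod>j<d. 1 - x j) \<le> x d * 1"
    by (intro mult_left_mono) auto
  with Suc show ?case by (simp add: algebra_simps)
qed simp

text \<open>If \<open>N\<close> points are split into \<open>m\<close> classes of sizes
  \<open>n i\<close>, then up to a factor 2 at least a fraction \<open>m^(1-d)\<close> of all
  \<open>d\<close>-sets lies inside one class. By Jensen the loss against \<open>N^d\<close> is the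
  product of \<open>1 - j * m / N\<close>, which is at least 1/2 because
  \<open>m * d^2 <= N\<close>.\<close>

lemma sum_choose_ge:
  fixes n :: "'a \<Rightarrow> nat"
  assumes "finite I" "I \<noteq> {}" and d: "d \<ge> 1" and N: "card I * d\<^sup>2 \<le> (\<Sum>i\<in>I. n i)"
  shows "real (card I) * real ((\<Sum>i\<in>I. n i) choose d)
    \<le> 2 * real (card I) ^ d * (\<Sum>i\<in>I. real (n i choose d))"
proof -
  define m where "m = card I"
  define N where "N = (\<Sum>i\<in>I. n i)"
  have m: "m > 0" using assms by (simp add: card_gt_0_iff m_def)
  have Nm: "m * d\<^sup>2 \<le> N" using N by (simp add: m_def N_def)
  have "m * 1 \<le> m * d\<^sup>2" using d by (intro mult_left_mono) auto
  then have N0: "N > 0" using Nm m by linarith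
  have ff: "(\<Prod>j<d. real x - real j) = real (x choose d) * fact d" for x
    by (simp add: binomial_gbinomial gbinomial_prod_rev atLeast0LessThan)
  have "d \<le> d\<^sup>2" using d by (simp add: power2_eq_square)
  then have "(d - 1) * m \<le> m * d\<^sup>2"
    by (subst mult.commute, intro mult_left_mono) auto
  then have *: "(d - 1) * m \<le> N" using Nm by linarith
  have jm: "real j * m \<le> N" if "j < d" for j
  proof -
    have "j * m \<le> (d - 1) * m" using that by (intro mult_right_mono) auto
    with * have "j * m \<le> N" by linarith
    then show ?thesis by (metis of_nat_mult of_nat_le_iff)
  qed
  have "(\<Sum>j<d. real j * m / N) \<le> 1 / 2"
  proof -
    have "2 * (\<Sum>j<d. real j) \<le> real (d^2)"
      by (induction d) (auto simp: power2_eq_square algebra_simps)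
    then have "(2 * (\<Sum>j<d. real j)) * m \<le> real (d^2) * m" by (rule mult_right_mono) simp
    also have "\<dots> \<le> N" using Nm by (metis mult.commute of_nat_le_iff of_nat_mult)
    finally show ?thesis using N0 by (simp add: field_simps flip: sum_distrib_right sum_divide_distrib)
  qed
  moreover have "1 - (\<Sum>j<d. real j * m / N) \<le> (\<Prod>j<d. 1 - real j * m / N)"
    using jm N0 by (intro prod_one_minus_ge) auto
  ultimately have half: "1 / 2 \<le> (\<Prod>j<d. 1 - real j * m / N)" by linarith
  have "real (N choose d) * fact d \<le> real N ^ d"
  proof -
    have "(\<Prod>j<d. real N - real j) \<le> (\<Prod>j<d. real N)" if "d \<le> N"
      using that by (intro prod_mono) auto
    then show ?thesis unfolding ff[symmetric]
      by (cases "d \<le> N") (simp_all add: ff binomial_eq_0)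
  qed
  also have "real N ^ d \<le> 2 * (real N ^ d * (\<Prod>j<d. 1 - real j * m / N))"
    using mult_left_mono[OF half, of "real N ^ d"] by simp
  also have "real N ^ d * (\<Prod>j<d. 1 - real j * m / N) = (\<Prod>j<d. real N * (1 - real j * m / N))"
    by (simp add: prod.distrib)
  also have "\<dots> = (\<Prod>j<d. real m * (real N / m - real j))"
    using m N0 by (intro prod.cong) (auto simp: field_simps)
  also have "\<dots> = real m ^ d * (\<Prod>j<d. real N / m - real j)"
    by (simp add: prod.distrib)
  finally have 1: "real (N choose d) * fact d \<le> 2 * (real m ^ d * (\<Prod>j<d. real N / m - real j))" .
  have 2: "real m * (\<Prod>j<d. real N / m - real j) \<le> (\<Sum>i\<in>I. \<Prod>j<d. real (n i) - real j)"
    using sum_falling_factorial_ge[OF assms(1,2), of d n] * unfolding m_def N_def by simp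
  have "real m * (real (N choose d) * fact d) \<le> real m * (2 * (real m ^ d * (\<Prod>j<d. real N / m - real j)))"
    using 1 by (rule mult_left_mono) simp
  also have "\<dots> = 2 * real m ^ d * (real m * (\<Prod>j<d. real N / m - real j))" by simp
  also have "\<dots> \<le> 2 * real m ^ d * (\<Sum>i\<in>I. \<Prod>j<d. real (n i) - real j)"
    using 2 by (rule mult_left_mono) simp
  also have "\<dots> = 2 * real m ^ d * (\<Sum>i\<in>I. real (n i choose d)) * fact d"
    by (simp add: ff sum_distrib_right)
  finally show ?thesis by (simp add: m_def N_def)
qed

text \<open>Double counting of the pairs \<open>(w, D)\<close> with \<open>w\<close> constant on the
  \<open>d\<close>-set \<open>D\<close>: each word has at least
  \<open>m^(1-d) * (N choose d) / 2\<close> of them, and in total there are at most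
  \<open>(N choose d) * m^(N-d)\<close>. The index set \<open>G\<close> carries no order here; the
  order enters only when \<open>free\<close> is derived from the pattern.\<close>

lemma card_words_le:
  fixes F :: "('a \<Rightarrow> nat) set"
  assumes G: "finite G" and F: "F \<subseteq> G \<rightarrow>\<^sub>E {..<m}"
    and m: "m \<ge> 1" and d: "d \<ge> 1" and N: "m * d\<^sup>2 \<le> card G"
    and free: "\<And>v w i i' D. v \<in> F \<Longrightarrow> w \<in> F \<Longrightarrow> D \<subseteq> G \<Longrightarrow> card D = d \<Longrightarrow> i < i' \<Longrightarrow> i' < m \<Longrightarrow>
      (\<And>j. j \<in> D \<Longrightarrow> v j = i \<and> w j = i') \<Longrightarrow> (\<And>j. j \<in> G - D \<Longrightarrow> v j = w j) \<Longrightarrow> False"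
  shows "m * card F \<le> 2 * m ^ card G"
proof -
  define J where "J w i = {j\<in>G. w j = i}" for w :: "'a \<Rightarrow> nat" and i
  define E where "E w = (\<Union>i<m. {D. D \<subseteq> J w i \<and> card D = d})" for w
  define N where "N = card G"
  have finF: "finite F" using F G finite_PiE finite_subset by (metis finite_lessThan)
  have finJ: "finite (J w i)" for w i using G by (simp add: J_def)
  have cardE: "card (E w) = (\<Sum>i<m. card (J w i) choose d)" for w
    unfolding E_def
  proof (subst card_UN_disjoint)
    show "\<forall>i\<in>{..<m}. finite {D. D \<subseteq> J w i \<and> card D = d}" using finJ by simp
    \<comment> \<open>Since \<open>d\<close> is positive, \<open>D\<close> is nonempty and
      determines its letter, so the union over letters is disjoint.\<close>
    have False if "D \<subseteq> J w i" "D \<subseteq> J w j" "i \<noteq> j" and D: "card D = d" for D i j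
    proof -
      obtain x where "x \<in> D" using d D by (metis all_not_in_conv card.empty not_one_le_zero)
      with that show False by (auto simp: J_def)
    qed
    then show "\<forall>i\<in>{..<m}. \<forall>j\<in>{..<m}. i \<noteq> j \<longrightarrow>
       {D. D \<subseteq> J w i \<and> card D = d} \<inter> {D. D \<subseteq> J w j \<and> card D = d} = {}" by blast
  qed (use finJ in \<open>auto simp: n_subsets\<close>)
  have finE: "finite (E w)" for w using finJ by (auto simp: E_def)
  have sumJ: "(\<Sum>i<m. card (J w i)) = N" if "w \<in> F" for w
  proof -
    have "(\<Sum>i<m. card (J w i)) = card (\<Union>i<m. J w i)"
      using finJ by (subst card_UN_disjoint) (auto simp: J_def)
    also have "(\<Union>i<m. J w i) = G" using F that by (auto simp: J_def)
    finally show ?thesis by (simp add: N_def)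
  qed
  have lower: "real m * real (N choose d) \<le> 2 * real m ^ d * real (card (E w))" if "w \<in> F" for w
    using sum_choose_ge[of "{..<m}" d "\<lambda>i. card (J w i)"] m d N sumJ[OF that]
    unfolding cardE N_def by (simp add: of_nat_sum lessThan_empty_iff)
  let ?S = "SIGMA D:{D. D \<subseteq> G \<and> card D = d}. (G - D) \<rightarrow>\<^sub>E {..<m}"
  let ?h = "\<lambda>(w, D). (D, restrict w (G - D))"
  have finS: "finite {D. D \<subseteq> G \<and> card D = d}" using G by simp
  have const: "\<exists>i<m. \<forall>j\<in>D. w j = i" "D \<subseteq> G" "card D = d" if "D \<in> E w" for D w
    using that by (auto simp: E_def J_def)
  have inj: "inj_on ?h (SIGMA w:F. E w)"
  proof (rule inj_onI)
    fix p q assume "p \<in> (SIGMA w:F. E w)" "q \<in> (SIGMA w:F. E w)" "?h p = ?h q"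
    then obtain v w D D' where pq: "p = (v, D)" "q = (w, D')"
      and vw: "v \<in> F" "w \<in> F" "D \<in> E v" "D' \<in> E w"
      and eq: "D = D'" "restrict v (G - D) = restrict w (G - D')"
      by auto
    have off: "v j = w j" if "j \<in> G - D" for j
      using eq that by (metis restrict_apply')
    obtain i i' where i: "i < m" "\<And>j. j \<in> D \<Longrightarrow> v j = i" "i' < m" "\<And>j. j \<in> D \<Longrightarrow> w j = i'"
      using const(1)[OF vw(3)] const(1)[OF vw(4)] eq by blast
    \<comment> \<open>\<open>free\<close> speaks only of \<open>i < i'\<close>, so it is applied to
      \<open>v, w\<close> and to \<open>w, v\<close>.\<close>
    have "i = i'"
      using free[of v w D i i'] free[of w v D i' i] vw i off const(2,3)[OF vw(3)]
      by (metis linorder_neqE_nat)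
    then have "v j = w j" if "j \<in> G" for j using i off that by (cases "j \<in> D") auto
    then have "v = w" using vw F by (intro PiE_ext[of v G "\<lambda>_. {..<m}" w]) blast+
    with eq pq show "p = q" by simp
  qed
  have "card (SIGMA w:F. E w) \<le> card ?S"
  proof (rule card_inj_on_le[OF inj])
    show "?h ` (SIGMA w:F. E w) \<subseteq> ?S"
      using const(2,3) F by (fastforce simp: PiE_iff)
    show "finite ?S" using finS G by (intro finite_SigmaI finite_PiE) auto
  qed
  also have "card ?S = (\<Sum>D\<in>{D. D \<subseteq> G \<and> card D = d}. m ^ (N - d))"
    using G finS by (subst card_SigmaI)
      (auto intro!: sum.cong simp del: sum_constant
        simp: card_PiE finite_PiE card_Diff_subset finite_subset N_def)
  also have "\<dots> = (N choose d) * m ^ (N - d)"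
    using G by (simp add: n_subsets N_def)
  finally have "(\<Sum>w\<in>F. card (E w)) \<le> (N choose d) * m ^ (N - d)"
    using finF finE by (simp add: card_SigmaI)
  then have upper: "(\<Sum>w\<in>F. real (card (E w))) \<le> real (N choose d) * real m ^ (N - d)"
    by (metis of_nat_le_iff of_nat_mult of_nat_power of_nat_sum)
  \<comment> \<open>This makes \<open>N - d\<close> a true difference and \<open>N choose d\<close>
    positive, so that it can be cancelled.\<close>
  have "1 * d \<le> m * d\<^sup>2" using m d by (intro mult_mono) (auto simp: power2_eq_square)
  then have dN: "d \<le> N" using N N_def by linarith
  have "real (card F) * (real m * real (N choose d)) \<le> (\<Sum>w\<in>F. 2 * real m ^ d * real (card (E w)))"
    using lower by (subst sum_constant[symmetric]) (rule sum_mono)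
  also have "\<dots> \<le> 2 * real m ^ d * (real (N choose d) * real m ^ (N - d))"
    using mult_left_mono[OF upper, of "2 * real m ^ d"] by (simp flip: sum_distrib_left)
  also have "\<dots> = 2 * real m ^ N * real (N choose d)"
    using dN by (simp flip: power_add add: mult_ac)
  finally have "(real m * real (card F)) * real (N choose d) \<le> 2 * real m ^ N * real (N choose d)"
    by (simp add: mult_ac)
  then have "real m * real (card F) \<le> 2 * real m ^ N"
    using dN by (simp add: zero_less_binomial)
  then show ?thesis
    unfolding N_def by (metis (mono_tags) of_nat_le_iff of_nat_mult of_nat_numeral of_nat_power)
qed

subsection \<open>Recognising the alternating pattern\<close>

lemma sorted_list_of_set_image:
  fixes e :: "'a::linorder \<Rightarrow> 'b::linorder"
  assumes "strict_mono_on X e" "finite X"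
  shows "sorted_list_of_set (e ` X) = map e (sorted_list_of_set X)"
proof (rule strict_sorted_equal)
  have "sorted_wrt (<) (sorted_list_of_set X)" by simp
  then show "sorted_wrt (<) (map e (sorted_list_of_set X))"
    unfolding sorted_wrt_map
    by (rule sorted_wrt_mono_rel[rotated]) (use assms in \<open>auto simp: strict_mono_on_def\<close>)
qed (use assms in auto)

text \<open>Patterns see only the relative order of points. This permits relabelling an arbitrary
  \<open>2 * k\<close>-set as an initial segment.\<close>

lemma pat_image:
  assumes e: "strict_mono_on S e" and S: "A \<subseteq> S" "B \<subseteq> S" and fin: "finite A" "finite B"
  shows "pat (e ` A) (e ` B) = pat A B"
proof -
  have inj: "inj_on e S" using e by (rule strict_mono_on_imp_inj_on)
  have diff: "e ` X - e ` Y = e ` (X - Y)" if "X \<subseteq> S" "Y \<subseteq> S" for X Y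
    using that inj by (auto simp: inj_on_def)
  have sym: "sym_diff (e ` A) (e ` B) = e ` sym_diff A B"
    using S by (simp add: diff image_Un)
  have "strict_mono_on (sym_diff A B) e"
    using e by (rule monotone_on_subset) (use S in blast)
  then have *: "sorted_list_of_set (e ` sym_diff A B) = map e (sorted_list_of_set (sym_diff A B))"
    using fin by (intro sorted_list_of_set_image) auto
  have "e j \<in> e ` A - e ` B \<longleftrightarrow> j \<in> A - B" if "j \<in> sym_diff A B" for j
    using that S inj by (auto simp: inj_on_def)
  then show ?thesis
    unfolding pat_def sym * using fin by (simp cong: map_cong)
qed

text \<open>The interleaved list \<open>x 0, y 0, x 1, y 1, ...\<close> is strictly increasing with
  the right set of entries, so it is the sorted list in the definition of
  \<open>pat\<close>.\<close>

lemma pat_eq_AP: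
  assumes xy: "\<And>l. l < d \<Longrightarrow> x l < y l" "\<And>l. Suc l < d \<Longrightarrow> y l < x (Suc l)"
    and AB: "A - B = x ` {..<d}" "B - A = y ` {..<d}"
  shows "pat A B = AP d"
proof -
  define L where "L n = concat (map (\<lambda>l. [x l, y l]) [0..<n])" for n
  \<comment> \<open>The bound by the last entry \<open>y (n - 1)\<close> is what lets the next two
    points be appended; it is vacuous at \<open>n = 0\<close>.\<close>
  have L: "sorted_wrt (<) (L n) \<and> (\<forall>z\<in>set (L n). z \<le> y (n - 1))" if "n \<le> d" for n
    using that
  proof (induction n)
    case (Suc n)
    have "z < x n" if "z \<in> set (L n)" for z
    proof (cases n)
      case (Suc n')
      then have "z \<le> y n'" using Suc.IH Suc.prems that by simp
      also have "y n' < x n" using xy(2)[of n'] Suc Suc.prems by simp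
      finally show ?thesis .
    qed (use that in \<open>simp add: L_def\<close>)
    moreover from this have "z < y n" if "z \<in> set (L n)" for z
      using that xy(1)[of n] Suc.prems by (meson Suc_le_lessD less_trans)
    moreover have "x n < y n" using xy(1) Suc.prems by simp
    moreover have "L (Suc n) = L n @ [x n, y n]" by (simp add: L_def)
    ultimately show ?case using Suc by (auto simp: sorted_wrt_append less_imp_le)
  qed (simp add: L_def)
  have set: "set (L d) = sym_diff A B" unfolding AB by (auto simp: L_def)
  have "sorted_list_of_set (sym_diff A B) = L d"
    using L[of d] by (intro strict_sorted_equal) (auto simp: set[symmetric])
  moreover have "x l \<in> A - B" "y l \<notin> A - B" if "l < d" for l
    using that AB by auto
  ultimately have "pat A B = concat (map (\<lambda>l. [Plus, Minus]) [0..<d])"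
    by (auto simp: pat_def L_def map_concat intro!: arg_cong[where f = concat])
  then show ?thesis by (simp add: AP_def map_replicate_const)
qed

text \<open>Within a block the point of \<open>A\<close> comes before that of \<open>B\<close>
  because \<open>i < i'\<close>, and \<open>i' < m\<close> keeps both before the next block, so the
  signs alternate.\<close>

lemma pat_blocks:
  assumes "finite D" "i < i'" "i' < m"
    and "A - B = (\<lambda>j. j * m + i) ` D" "B - A = (\<lambda>j. j * m + i') ` D"
  shows "pat A B = AP (card D)"
proof (rule pat_eq_AP)
  define f where "f l = sorted_list_of_set D ! l" for l
  have fD: "f ` {..<card D} = D"
    using nth_image[of "card D" "sorted_list_of_set D"] assms(1)
    by (simp add: f_def image_def lessThan_def atLeast0LessThan)
  have "(\<lambda>j. j * m + c) ` (f ` {..<card D}) = (\<lambda>l. f l * m + c) ` {..<card D}" for c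
    by (rule image_image)
  note img = this[unfolded fD]
  show "A - B = (\<lambda>l. f l * m + i) ` {..<card D}" "B - A = (\<lambda>l. f l * m + i') ` {..<card D}"
    by (simp_all only: assms(4,5) img)
  show "f l * m + i < f l * m + i'" for l using assms by simp
  show "f l * m + i' < f (Suc l) * m + i" if "Suc l < card D" for l
  proof -
    have "f l < f (Suc l)"
      unfolding f_def using that assms(1)
      by (intro sorted_wrt_nth_less[of "(<)"]) auto
    then have "Suc (f l) * m \<le> f (Suc l) * m" by (intro mult_right_mono) auto
    then show ?thesis using assms by simp
  qed
qed

subsection \<open>Binomial estimates\<close>

lemma binomial_pred_upper: "(real n - real r) * real (n choose r) = real n * real ((n - 1) choose r)"
proof (cases "r \<le> n")
  case True
  then show ?thesis using binomial_absorb_comp[of n r]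
    by (metis of_nat_diff of_nat_mult)
qed (simp add: binomial_eq_0)

text \<open>A fixed block is good with probability at least \<open>m / 3^m\<close>. After
  \<open>(2k choose k) = 2 * (2k-1 choose k-1)\<close>, each lowering of the upper index costs a
  factor \<open>(2k-1-j) / (k-j)\<close>, which is at most 3 as long as \<open>j < m\<close> and
  \<open>2 * m <= k\<close>.\<close>

lemma central_binomial_le:
  assumes "m \<ge> 1" "2 * m \<le> k"
  shows "(2 * k) choose k \<le> 3 ^ m * ((2 * k - m) choose (k - 1))"
proof -
  have *: "(2 * k - 1) choose (k - 1) \<le> 3 ^ j * ((2 * k - 1 - j) choose (k - 1))" if "j < m" for j
    using that
  proof (induction j)
    case (Suc j)
    have "real (k - j) * real ((2 * k - 1 - j) choose (k - 1)) = real (2 * k - 1 - j) * real ((2 * k - 1 - Suc j) choose (k - 1))"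
      using binomial_pred_upper[of "2 * k - 1 - j" "k - 1"] assms Suc.prems by (simp add: of_nat_diff)
    also have "real (2 * k - 1 - j) * real ((2 * k - 1 - Suc j) choose (k - 1))
       \<le> (3 * real (k - j)) * real ((2 * k - 1 - Suc j) choose (k - 1))"
      using assms Suc.prems by (intro mult_right_mono) auto
    finally have "real (k - j) * real ((2 * k - 1 - j) choose (k - 1))
       \<le> real (k - j) * real (3 * ((2 * k - 1 - Suc j) choose (k - 1)))" by simp
    then have "(2 * k - 1 - j) choose (k - 1) \<le> 3 * ((2 * k - 1 - Suc j) choose (k - 1))"
      using assms Suc.prems by (simp only: mult_le_cancel_left_pos of_nat_0_less_iff of_nat_le_iff zero_less_diff)
    then have "3 ^ j * ((2 * k - 1 - j) choose (k - 1)) \<le> 3 ^ j * (3 * ((2 * k - 1 - Suc j) choose (k - 1)))"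
      by (rule mult_left_mono) simp
    with Suc have "(2 * k - 1) choose (k - 1) \<le> 3 ^ j * (3 * ((2 * k - 1 - Suc j) choose (k - 1)))"
      by (meson Suc_lessD le_trans)
    then show ?case by (simp add: mult_ac)
  qed simp
  have "k * ((2 * k) choose k) = k * (2 * ((2 * k - 1) choose (k - 1)))"
    using binomial_absorption[of "k - 1" "2 * k"] assms by (simp add: mult_ac)
  then have "(2 * k) choose k = 2 * ((2 * k - 1) choose (k - 1))" using assms by simp
  also have "\<dots> \<le> 2 * (3 ^ (m - 1) * ((2 * k - m) choose (k - 1)))"
    using *[of "m - 1"] assms by simp
  also have "\<dots> \<le> 3 ^ m * ((2 * k - m) choose (k - 1))"
    using assms by (cases m) auto
  finally show ?thesis .
qed

text \<open>Two blocks are both good with probability at most \<open>1 + 1/m\<close> times the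
  square of the probability for one. The sequence \<open>a\<close> descends from half the central
  coefficient to the one-block coefficient, and \<open>b\<close> ends at the two-block one. Step by
  step \<open>b\<close> shrinks at least as fast as \<open>a\<close>; the remaining quotient of
  \<open>b 0\<close> by the one-block coefficient is \<open>(k-1) / (2k-m)\<close>, and
  \<open>m^2 <= 2k\<close> bounds its double by \<open>1 + 1/m\<close>.\<close>

lemma central_binomial_pair_le:
  assumes "m \<ge> 3" "2 * m \<le> k" "m\<^sup>2 \<le> 2 * k"
  shows "m * ((2 * k - 2 * m) choose (k - 2)) * ((2 * k) choose k)
    \<le> (m + 1) * ((2 * k - m) choose (k - 1))\<^sup>2"
proof -
  define a where "a j = real ((2 * k - 1 - j) choose (k - 1))" for j
  define b where "b j = real ((2 * k - m - 1 - j) choose (k - 2))" for j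
  have "b j * a 0 \<le> a j * b 0" if "j < m" for j
    using that
  proof (induction j)
    case (Suc j)
    have a: "(real k - j) * a j = (2 * real k - 1 - j) * a (Suc j)"
      using binomial_pred_upper[of "2 * k - 1 - j" "k - 1"] assms Suc.prems by (simp add: of_nat_diff a_def)
    have b: "(real k - m + 1 - j) * b j = (2 * real k - m - 1 - j) * b (Suc j)"
      using binomial_pred_upper[of "2 * k - m - 1 - j" "k - 2"] assms Suc.prems
      by (simp add: of_nat_diff b_def algebra_simps)
    let ?u = "2 * real k - m - 1 - j" and ?v = "2 * real k - 1 - j"
    have pos: "?u > 0" "?v > 0" "real k - m + 1 - j > 0" using assms Suc.prems by auto
    have nn: "a i \<ge> 0" "b i \<ge> 0" for i by (auto simp: a_def b_def)
    \<comment> \<open>This is \<open>key\<close> below with all terms collected. The left side is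
      positive only for \<open>j = 0\<close>.\<close>
    have "(real m - 1) * (1 - real j) \<le> (real m - 2) * (real k - j)"
    proof (cases j)
      case 0
      have "real m - 1 \<le> (real m - 2) * 2" using assms by simp
      also have "\<dots> \<le> (real m - 2) * real k" using assms by (intro mult_left_mono) auto
      finally show ?thesis using 0 by simp
    next
      case (Suc j')
      then have "(real m - 1) * (1 - real j) \<le> 0" using assms by (intro mult_nonneg_nonpos) auto
      also have "0 \<le> (real m - 2) * (real k - j)" using assms Suc.prems by (intro mult_nonneg_nonneg) auto
      finally show ?thesis .
    qed
    then have key: "(real k - m + 1 - j) * ?v \<le> (real k - j) * ?u"
      by (simp add: algebra_simps)
    have "(?u * ?v) * (b (Suc j) * a 0) = ((real k - m + 1 - j) * ?v) * (b j * a 0)"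
      using b by (simp add: mult_ac)
    also have "\<dots> \<le> ((real k - j) * ?u) * (a j * b 0)"
      by (rule mult_mono[OF key]) (use Suc assms pos nn in auto)
    also have "\<dots> = (?u * ?v) * (a (Suc j) * b 0)"
      using a by (simp add: mult_ac)
    finally show ?case using pos by (simp add: mult_le_cancel_left_pos)
  qed simp
  then have *: "b (m - 1) * a 0 \<le> a (m - 1) * b 0" using assms by simp
  define p1 where "p1 = real ((2 * k - m) choose (k - 1))"
  have a: "a (m - 1) = p1" using assms by (simp add: a_def p1_def)
  have "k * ((2 * k) choose k) = k * (2 * ((2 * k - 1) choose (k - 1)))"
    using binomial_absorption[of "k - 1" "2 * k"] assms by (simp add: mult_ac)
  then have M: "real ((2 * k) choose k) = 2 * a 0" using assms by (simp add: a_def)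
  have "(k - 1) * ((2 * k - m) choose (k - 1)) = (2 * k - m) * ((2 * k - m - 1) choose (k - 2))"
    using binomial_absorption[of "k - 2" "2 * k - m"] assms
    by (simp add: Suc_diff_Suc numeral_2_eq_2)
  then have "real (k - 1) * p1 = real (2 * k - m) * b 0"
    unfolding p1_def b_def by (metis diff_zero of_nat_mult)
  then have b: "(real k - 1) * p1 = (2 * real k - m) * b 0"
    using assms by (simp add: of_nat_diff)
  have p2: "real ((2 * k - 2 * m) choose (k - 2)) = b (m - 1)"
  proof -
    have "2 * k - m - 1 - (m - 1) = 2 * k - 2 * m" using assms by simp
    then show ?thesis by (simp only: b_def)
  qed
  have "real m ^ 2 \<le> real (2 * k)" using assms(3) by (metis of_nat_le_iff of_nat_power)
  then have km: "m * (2 * (real k - 1)) \<le> (real m + 1) * (2 * real k - m)"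
    by (simp add: algebra_simps power2_eq_square)
  have c: "2 * real k - m > 0" using assms by simp
  have "(2 * real k - m) * (m * (b (m - 1) * (2 * a 0))) \<le> (2 * real k - m) * (m * (2 * (p1 * b 0)))"
    using *[unfolded a] c by (intro mult_left_mono) auto
  also have "\<dots> = real m * 2 * p1 * ((2 * real k - m) * b 0)"
    by (simp only: mult_ac)
  also have "\<dots> = m * (2 * (real k - 1)) * (p1 * p1)"
    unfolding b[symmetric] by simp
  also have "\<dots> \<le> (real m + 1) * (2 * real k - m) * (p1 * p1)"
    using km by (intro mult_right_mono) auto
  finally have "m * (b (m - 1) * (2 * a 0)) \<le> (real m + 1) * (p1 * p1)"
    using c by (simp add: mult_ac)
  then have "real (m * ((2 * k - 2 * m) choose (k - 2)) * ((2 * k) choose k))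
    \<le> real ((m + 1) * ((2 * k - m) choose (k - 1))\<^sup>2)"
    by (simp only: of_nat_mult of_nat_add of_nat_1 of_nat_power M p2 power2_eq_square mult.assoc flip: p1_def)
  then show ?thesis by (simp only: of_nat_le_iff)
qed

subsection \<open>Counting blocks that meet a set in one point\<close>

text \<open>Deleting the prescribed trace is a bijection onto smaller subsets of
  \<open>U - T\<close>. With \<open>T = Z\<close> it counts supersets.\<close>

lemma card_nsets_trace:
  assumes "finite U" "T \<subseteq> U" "Z \<subseteq> T" "card Z \<le> k"
  shows "card {A \<in> nsets U k. A \<inter> T = Z} = (card U - card T) choose (k - card Z)"
proof -
  have fin: "finite T" "finite Z" using assms by (meson finite_subset)+
  have "bij_betw (\<lambda>A. A - T) {A \<in> nsets U k. A \<inter> T = Z} (nsets (U - T) (k - card Z))"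
  proof (rule bij_betw_byWitness[where f' = "\<lambda>R. R \<union> Z"])
    show "(\<lambda>A. A - T) ` {A \<in> nsets U k. A \<inter> T = Z} \<subseteq> nsets (U - T) (k - card Z)"
      using fin by (auto simp: nsets_def card_Diff_subset_Int)
    show "(\<lambda>R. R \<union> Z) ` nsets (U - T) (k - card Z) \<subseteq> {A \<in> nsets U k. A \<inter> T = Z}"
    proof clarify
      fix R assume R: "R \<in> nsets (U - T) (k - card Z)"
      then have "card (R \<union> Z) = k"
        using fin assms by (subst card_Un_disjoint) (auto simp: nsets_def)
      then show "R \<union> Z \<in> nsets U k \<and> (R \<union> Z) \<inter> T = Z"
        using R fin assms by (auto simp: nsets_def)
    qed
  qed (use assms in \<open>auto simp: nsets_def\<close>)
  then have "card {A \<in> nsets U k. A \<inter> T = Z} = card (nsets (U - T) (k - card Z))"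
    by (rule bij_betw_same_card)
  also have "\<dots> = card (U - T) choose (k - card Z)"
    using assms by (simp add: card_nsets)
  finally show ?thesis using assms fin by (simp add: card_Diff_subset)
qed

definition block :: "nat \<Rightarrow> nat \<Rightarrow> nat set" where
  "block m j = {x. x div m = j}"

text \<open>The indices of the good blocks. The bound \<open>b\<close> excludes a possibly
  incomplete block at the end of the ground set.\<close>

definition singletons :: "nat \<Rightarrow> nat \<Rightarrow> nat set \<Rightarrow> nat set" where
  "singletons m b A = {j \<in> {..<b}. \<exists>x. A \<inter> block m j = {x}}"

lemma finite_singletons [simp]: "finite (singletons m b A)"
  by (simp add: singletons_def)

lemma block_eq:
  assumes "m > 0"
  shows "block m j = {j * m..<j * m + m}"
proof -
  have "x \<in> {j * m..<j * m + m}" if "x \<in> block m j" for x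
  proof -
    have "j * m + x mod m = x" using that div_mult_mod_eq[of x m] by (simp add: block_def)
    moreover have "x mod m < m" using assms by simp
    ultimately show ?thesis unfolding atLeastLessThan_iff by linarith
  qed
  moreover have "x \<in> block m j" if "x \<in> {j * m..<j * m + m}" for x
    using that by (auto simp: block_def mult.commute[of m] intro!: div_nat_eqI)
  ultimately show ?thesis by blast
qed

lemma
  assumes "m > 0"
  shows finite_block [simp]: "finite (block m j)" and card_block [simp]: "card (block m j) = m"
  using assms by (simp_all add: block_eq)

lemma block_subset:
  assumes "m > 0" "j < b" "b * m \<le> n"
  shows "block m j \<subseteq> {..<n}"
proof -
  have "Suc j * m \<le> b * m" using assms by (intro mult_right_mono) auto
  then show ?thesis using assms by (auto simp: block_eq)
qed

lemma card_singleton_trace: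
  assumes "m > 0" "j < b" "b * m \<le> n" "k \<ge> 1"
  shows "card {A \<in> nsets {..<n} k. j \<in> singletons m b A} = m * ((n - m) choose (k - 1))"
proof -
  have "{A \<in> nsets {..<n} k. j \<in> singletons m b A}
      = (\<Union>x\<in>block m j. {A \<in> nsets {..<n} k. A \<inter> block m j = {x}})"
    using assms by (auto simp: singletons_def)
  also have "card \<dots> = (\<Sum>x\<in>block m j. card {A \<in> nsets {..<n} k. A \<inter> block m j = {x}})"
    using assms by (subst card_UN_disjoint) (auto simp: finite_imp_finite_nsets)
  also have "\<dots> = (\<Sum>x\<in>block m j. (n - m) choose (k - 1))"
    using assms block_subset[OF assms(1-3)] by (intro sum.cong refl, subst card_nsets_trace) auto
  finally show ?thesis using assms by simp
qed

lemma card_pair_singleton_trace: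
  assumes "m > 0" "j < b" "j' < b" "j \<noteq> j'" "b * m \<le> n" "k \<ge> 2"
  shows "card {A \<in> nsets {..<n} k. j \<in> singletons m b A \<and> j' \<in> singletons m b A}
     = m\<^sup>2 * ((n - 2 * m) choose (k - 2))"
proof -
  let ?B = "block m j" and ?B' = "block m j'"
  have disj: "?B \<inter> ?B' = {}" using assms by (auto simp: block_def)
  have "{A \<in> nsets {..<n} k. j \<in> singletons m b A \<and> j' \<in> singletons m b A}
      = (\<Union>p\<in>?B \<times> ?B'. {A \<in> nsets {..<n} k. A \<inter> (?B \<union> ?B') = {fst p, snd p}})" (is "?L = ?R")
  proof (intro equalityI subsetI)
    fix A assume A: "A \<in> ?L"
    then obtain x y where "A \<inter> ?B = {x}" "A \<inter> ?B' = {y}" by (auto simp: singletons_def)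
    then have "A \<inter> (?B \<union> ?B') = {x, y}" "x \<in> ?B" "y \<in> ?B'" by auto
    then show "A \<in> ?R" using A by auto
  next
    fix A assume A: "A \<in> ?R"
    then obtain x y where xy: "A \<inter> (?B \<union> ?B') = {x, y}" "x \<in> ?B" "y \<in> ?B'" by auto
    then have "A \<inter> ?B = {x}" "A \<inter> ?B' = {y}" using disj by blast+
    then show "A \<in> ?L" using A assms by (auto simp: singletons_def)
  qed
  also have "card \<dots> = (\<Sum>p\<in>?B \<times> ?B'. card {A \<in> nsets {..<n} k. A \<inter> (?B \<union> ?B') = {fst p, snd p}})"
  proof (subst card_UN_disjoint)
    have "p = q" if "p \<in> ?B \<times> ?B'" "q \<in> ?B \<times> ?B'" "{fst p, snd p} = {fst q, snd q}" for p q
      using that disj by (cases p; cases q) (auto simp: doubleton_eq_iff)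
    note eqI = this
    show "\<forall>p\<in>?B \<times> ?B'. \<forall>q\<in>?B \<times> ?B'. p \<noteq> q \<longrightarrow>
      {A \<in> nsets {..<n} k. A \<inter> (?B \<union> ?B') = {fst p, snd p}}
       \<inter> {A \<in> nsets {..<n} k. A \<inter> (?B \<union> ?B') = {fst q, snd q}} = {}"
    proof (intro ballI impI equals0I)
      fix p q A assume pq: "p \<in> ?B \<times> ?B'" "q \<in> ?B \<times> ?B'" "p \<noteq> q"
        and A: "A \<in> {A \<in> nsets {..<n} k. A \<inter> (?B \<union> ?B') = {fst p, snd p}}
          \<inter> {A \<in> nsets {..<n} k. A \<inter> (?B \<union> ?B') = {fst q, snd q}}"
      from A have "A \<inter> (?B \<union> ?B') = {fst p, snd p}" "A \<inter> (?B \<union> ?B') = {fst q, snd q}"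
        by blast+
      then have "{fst p, snd p} = {fst q, snd q}" by metis
      with eqI pq show False by blast
    qed
  qed (use assms in \<open>auto simp: finite_imp_finite_nsets\<close>)
  also have "\<dots> = (\<Sum>p\<in>?B \<times> ?B'. (n - 2 * m) choose (k - 2))"
  proof (rule sum.cong)
    fix p assume p: "p \<in> ?B \<times> ?B'"
    then have "fst p \<noteq> snd p" using disj by auto
    then have "card {fst p, snd p} = 2" by simp
    moreover have "card (?B \<union> ?B') = 2 * m"
      using assms disj by (simp add: card_Un_disjoint)
    ultimately show "card {A \<in> nsets {..<n} k. A \<inter> (?B \<union> ?B') = {fst p, snd p}} = (n - 2 * m) choose (k - 2)"
      using p assms block_subset[of m j b n] block_subset[of m j' b n]
      by (subst card_nsets_trace) auto
  qed simp
  finally show ?thesis using assms by (simp add: card_cartesian_product power2_eq_square)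
qed

text \<open>The sets counted have fewer than half the mean \<open>mu\<close> of good blocks. The
  variance is at most \<open>mu + mu^2 / m\<close>, hence at most \<open>2 * mu^2 / m\<close> since
  \<open>mu >= m\<close>; dividing by \<open>(mu / 2)^2\<close> gives \<open>8 / m\<close>.
  Everything is multiplied by \<open>M\<close>, the number of all \<open>k\<close>-sets, to stay
  with sums.\<close>

lemma card_few_singletons_le:
  assumes m: "m \<ge> 3" "2 * m \<le> k" "m\<^sup>2 \<le> 2 * k" and b: "b * m \<le> 2 * k" "3 ^ m \<le> b"
  shows "m * card {A \<in> nsets {..<2 * k} k. 2 * 3 ^ m * card (singletons m b A) < b * m} \<le> 8 * ((2 * k) choose k)"
proof -
  define Om where "Om = nsets {..<2 * k} k"
  define M p1 p2 where "M = real ((2 * k) choose k)" and "p1 = real ((2 * k - m) choose (k - 1))"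
    and "p2 = real ((2 * k - 2 * m) choose (k - 2))"
  define N where "N A = real (card (singletons m b A))" for A
  define mu where "mu = b * m * p1 / M"
  have fin: "finite Om" by (simp add: Om_def finite_imp_finite_nsets)
  have M: "M > 0" by (simp add: M_def zero_less_binomial)
  have "real ((2 * k) choose k) \<le> real (3 ^ m * ((2 * k - m) choose (k - 1)))"
    unfolding of_nat_le_iff using m by (intro central_binomial_le) auto
  then have "M \<le> 3 ^ m * p1" by (simp add: M_def p1_def)
  then have "b * m * M \<le> b * m * (3 ^ m * p1)" by (intro mult_left_mono) auto
  then have mu_ge: "b * m \<le> 3 ^ m * mu" using M by (simp add: mu_def field_simps)
  have "real (3 ^ m * m) \<le> real (b * m)" using b(2) by (simp only: of_nat_le_iff mult_right_mono)
  then have "3 ^ m * real m \<le> b * m" by simp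
  then have "3 ^ m * real m \<le> 3 ^ m * mu" using mu_ge by linarith
  then have mu_m: "m \<le> mu" by simp
  have "real (m * ((2 * k - 2 * m) choose (k - 2)) * ((2 * k) choose k))
    \<le> real ((m + 1) * ((2 * k - m) choose (k - 1))\<^sup>2)"
    using central_binomial_pair_le[OF m] by (simp only: of_nat_le_iff)
  then have pair: "m * (p2 * M) \<le> (real m + 1) * p1\<^sup>2"
    by (simp add: p1_def p2_def M_def mult.assoc distrib_right)
  have sing: "N A = (\<Sum>j<b. of_bool (j \<in> singletons m b A))" for A
  proof -
    have "{..<b} \<inter> {j. j \<in> singletons m b A} = singletons m b A" by (auto simp: singletons_def)
    then show ?thesis by (simp add: N_def of_bool_def sum.If_cases)
  qed
  have ind: "(\<Sum>A\<in>Om. of_bool (P A)) = real (card {A \<in> Om. P A})" for P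
  proof -
    have "{A \<in> Om. P A} = Om \<inter> {A. P A}" by auto
    then show ?thesis using fin by (simp add: of_bool_def sum.If_cases)
  qed
  have "(\<Sum>A\<in>Om. N A) = (\<Sum>j<b. \<Sum>A\<in>Om. of_bool (j \<in> singletons m b A))"
    unfolding sing by (rule sum.swap)
  also have "\<dots> = (\<Sum>j<b. m * p1)"
    unfolding ind using m b by (intro sum.cong refl) (simp add: Om_def card_singleton_trace p1_def)
  finally have S1: "(\<Sum>A\<in>Om. N A) = M * mu" using M by (simp add: mu_def)
  have "(\<Sum>A\<in>Om. (N A)\<^sup>2)
     = (\<Sum>A\<in>Om. \<Sum>j<b. \<Sum>j'<b. of_bool (j \<in> singletons m b A \<and> j' \<in> singletons m b A))"
    unfolding sing power2_eq_square sum_product by (simp add: of_bool_conj)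
  also have "\<dots> = (\<Sum>j<b. \<Sum>A\<in>Om. \<Sum>j'<b. of_bool (j \<in> singletons m b A \<and> j' \<in> singletons m b A))"
    by (rule sum.swap)
  also have "\<dots> = (\<Sum>j<b. \<Sum>j'<b. \<Sum>A\<in>Om. of_bool (j \<in> singletons m b A \<and> j' \<in> singletons m b A))"
    by (intro sum.cong refl sum.swap)
  \<comment> \<open>The off-diagonal value is added on the diagonal too, so that it occurs
    \<open>b^2\<close> times and compares directly with \<open>mu^2\<close>.\<close>
  also have "\<dots> \<le> (\<Sum>j<b. \<Sum>j'<b. (if j' = j then m * p1 else 0) + m\<^sup>2 * p2)"
  proof (intro sum_mono)
    fix j j' assume j: "j \<in> {..<b}" "j' \<in> {..<b}"
    show "(\<Sum>A\<in>Om. of_bool (j \<in> singletons m b A \<and> j' \<in> singletons m b A))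
       \<le> (if j' = j then m * p1 else 0) + m\<^sup>2 * p2"
      unfolding ind using j m b
      by (cases "j' = j")
        (simp_all add: Om_def card_singleton_trace card_pair_singleton_trace p1_def p2_def)
  qed
  also have "\<dots> = M * mu + b\<^sup>2 * m\<^sup>2 * p2"
    using M by (simp add: sum.distrib mu_def power2_eq_square distrib_left mult.assoc)
  finally have S2: "(\<Sum>A\<in>Om. (N A)\<^sup>2) \<le> M * mu + b\<^sup>2 * m\<^sup>2 * p2" .
  have "m * (b\<^sup>2 * m\<^sup>2 * p2) = (b\<^sup>2 * m\<^sup>2 / M) * (m * (p2 * M))" using M by simp
  also have "\<dots> \<le> (b\<^sup>2 * m\<^sup>2 / M) * ((real m + 1) * p1\<^sup>2)"
    using pair M by (intro mult_left_mono) auto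
  also have "\<dots> = (real m + 1) * (M * mu\<^sup>2)"
    using M by (simp add: mu_def power2_eq_square)
  finally have E: "m * (b\<^sup>2 * m\<^sup>2 * p2) \<le> (real m + 1) * (M * mu\<^sup>2)" .
  have "card Om = (2 * k) choose k" by (simp add: Om_def card_nsets)
  then have cOm: "real (card Om) = M" by (simp add: M_def)
  have "(\<Sum>A\<in>Om. (N A - mu)\<^sup>2) = (\<Sum>A\<in>Om. (N A)\<^sup>2 - 2 * mu * N A + mu\<^sup>2)"
    by (simp add: power2_diff algebra_simps)
  also have "\<dots> = (\<Sum>A\<in>Om. (N A)\<^sup>2) - 2 * mu * (\<Sum>A\<in>Om. N A) + M * mu\<^sup>2"
    by (simp add: sum.distrib sum_subtractf cOm flip: sum_distrib_left)
  finally have "(\<Sum>A\<in>Om. (N A - mu)\<^sup>2) = (\<Sum>A\<in>Om. (N A)\<^sup>2) - 2 * mu * (\<Sum>A\<in>Om. N A) + M * mu\<^sup>2" .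
  then have "(\<Sum>A\<in>Om. (N A - mu)\<^sup>2) \<le> M * mu + b\<^sup>2 * m\<^sup>2 * p2 - M * mu\<^sup>2"
    using S1 S2 by (simp add: power2_eq_square)
  then have "m * (\<Sum>A\<in>Om. (N A - mu)\<^sup>2) \<le> m * (M * mu + b\<^sup>2 * m\<^sup>2 * p2 - M * mu\<^sup>2)"
    by (rule mult_left_mono) simp
  moreover have "m * (M * mu) \<le> mu * (M * mu)"
    using mu_m M by (intro mult_right_mono mult_nonneg_nonneg) auto
  ultimately have V: "m * (\<Sum>A\<in>Om. (N A - mu)\<^sup>2) \<le> 2 * M * mu\<^sup>2"
    using E by (simp add: algebra_simps power2_eq_square)
  define Bad where "Bad = {A \<in> Om. 2 * 3 ^ m * card (singletons m b A) < b * m}"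
  have "real (card Bad) * (mu / 2)\<^sup>2 = (\<Sum>A\<in>Bad. (mu / 2)\<^sup>2)" by simp
  also have "\<dots> \<le> (\<Sum>A\<in>Bad. (N A - mu)\<^sup>2)"
  proof (rule sum_mono)
    fix A assume "A \<in> Bad"
    then have "2 * 3 ^ m * card (singletons m b A) < b * m" by (simp add: Bad_def)
    then have "real (2 * 3 ^ m * card (singletons m b A)) < real (b * m)" by (simp only: of_nat_less_iff)
    then have "3 ^ m * (2 * N A) < real (b * m)" by (simp add: N_def mult_ac)
    also note mu_ge
    finally have "2 * N A < mu" by simp
    then have "mu / 2 \<le> mu - N A" by simp
    then have "(mu / 2)\<^sup>2 \<le> (mu - N A)\<^sup>2" using mu_m by (intro power_mono) auto
    then show "(mu / 2)\<^sup>2 \<le> (N A - mu)\<^sup>2" by (simp add: power2_commute)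
  qed
  also have "\<dots> \<le> (\<Sum>A\<in>Om. (N A - mu)\<^sup>2)"
    using fin by (intro sum_mono2) (auto simp: Bad_def)
  finally have "m * (real (card Bad) * (mu / 2)\<^sup>2) \<le> 2 * M * mu\<^sup>2"
    using V by (meson mult_left_mono of_nat_0_le_iff order_trans)
  moreover have "mu > 0" using mu_m m by linarith
  ultimately have "m * real (card Bad) \<le> 8 * M"
    by (simp add: power2_eq_square field_simps)
  then have "real (m * card Bad) \<le> real (8 * ((2 * k) choose k))" by (simp add: M_def)
  then show ?thesis unfolding Bad_def Om_def by (simp only: of_nat_le_iff)
qed

subsection \<open>From sets to words\<close>

text \<open>The \<open>k\<close>-sets are partitioned by \<open>cls\<close>. Each class met by the
  family is a full cube of words, one letter per good block, so the word bound applies class by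
  class and adds up.\<close>

lemma card_many_singletons_le:
  assumes m: "m > 0" and d: "d \<ge> 1" and b: "b * m \<le> n"
    and F: "F \<subseteq> nsets {..<n} k" and free: "pattern_free (AP d) F"
  shows "m * card {A \<in> F. m * d\<^sup>2 \<le> card (singletons m b A)} \<le> 2 * (n choose k)"
proof -
  define Om where "Om = nsets {..<n} k"
  \<comment> \<open>The good indices must be recorded: once its point is deleted, a good block looks
    like an empty one.\<close>
  define cls where "cls A = (singletons m b A, A - (\<Union>j\<in>singletons m b A. block m j))" for A
  define Fb where "Fb = {A \<in> F. m * d\<^sup>2 \<le> card (singletons m b A)}"
  have finOm: "finite Om" by (simp add: Om_def finite_imp_finite_nsets)
  have FOm: "F \<subseteq> Om" using F by (simp add: Om_def)
  have finF: "finite F" using FOm finOm finite_subset by blast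
  have class_le: "m * card {A \<in> F. cls A = cls A0} \<le> 2 * card {A \<in> Om. cls A = cls A0}"
    if A0: "A0 \<in> Fb" for A0
  proof -
    define G R where "G = singletons m b A0" and "R = A0 - (\<Union>j\<in>G. block m j)"
    define W where "W = (G \<rightarrow>\<^sub>E {..<m})"
    define \<phi> where "\<phi> w = R \<union> (\<lambda>j. j * m + w j) ` G" for w
    have A0': "A0 \<subseteq> {..<n}" "finite A0" "card A0 = k" "A0 \<in> Om"
      using A0 F by (auto simp: Fb_def nsets_def Om_def)
    have finG: "finite G" by (simp add: G_def)
    have Gb: "j < b" if "j \<in> G" for j using that by (simp add: G_def singletons_def)
    have wm: "w j < m" if "w \<in> W" "j \<in> G" for w j using that by (auto simp: W_def)
    have inblock: "j * m + w j \<in> block m j" if "w \<in> W" "j \<in> G" for w j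
      using wm[OF that] m by (simp add: block_def)
    have trace: "\<phi> w \<inter> block m j = (if j \<in> G then {j * m + w j} else A0 \<inter> block m j)"
      if "w \<in> W" for w j
    proof -
      have "j' = j" if "j' \<in> G" "j' * m + w j' \<in> block m j" for j'
        using inblock[OF \<open>w \<in> W\<close> that(1)] that(2) by (simp add: block_def)
      then show ?thesis using inblock[OF that] by (auto simp: \<phi>_def R_def block_def)
    qed
    \<comment> \<open>Moving the points inside good blocks neither creates nor destroys good blocks,
      so the word stays in its class.\<close>
    have sing: "singletons m b (\<phi> w) = G" if "w \<in> W" for w
    proof -
      have "(\<exists>x. \<phi> w \<inter> block m j = {x}) \<longleftrightarrow> j \<in> G" if "j < b" for j
      proof (cases "j \<in> G")
        case False
        then have "\<not> (\<exists>x. A0 \<inter> block m j = {x})" using that by (simp add: G_def singletons_def)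
        then show ?thesis using trace[OF \<open>w \<in> W\<close>, of j] False by simp
      qed (use trace[OF \<open>w \<in> W\<close>] in simp)
      then show ?thesis using Gb unfolding singletons_def by blast
    qed
    have cls: "cls (\<phi> w) = cls A0" if "w \<in> W" for w
      using inblock[OF that] unfolding cls_def sing[OF that] G_def[symmetric]
      by (auto simp: \<phi>_def R_def)
    have card\<phi>: "card (\<phi> w) = card R + card G" if "w \<in> W" for w
    proof -
      have "inj_on (\<lambda>j. j * m + w j) G"
        using inblock[OF that] by (intro inj_onI) (metis (mono_tags) block_def mem_Collect_eq)
      moreover have "R \<inter> (\<lambda>j. j * m + w j) ` G = {}"
        using inblock[OF that] by (auto simp: R_def)
      ultimately show ?thesis
        using finG A0' by (simp add: \<phi>_def R_def card_Un_disjoint card_image)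
    qed
    have surj: "\<exists>w\<in>W. A = \<phi> w" if "cls A = cls A0" for A
    proof -
      have GA: "singletons m b A = G" and RA: "R = A - (\<Union>j\<in>G. block m j)"
        using that by (auto simp: cls_def G_def R_def)
      have "\<forall>j\<in>G. \<exists>x. A \<inter> block m j = {x}" using GA by (auto simp: singletons_def)
      then obtain f where f: "\<And>j. j \<in> G \<Longrightarrow> A \<inter> block m j = {f j}" by metis
      define w where "w = (\<lambda>j\<in>G. f j mod m)"
      have "j * m + w j = f j" if "j \<in> G" for j
      proof -
        have "f j div m = j" using f[OF that] by (auto simp: block_def)
        then show ?thesis using that div_mult_mod_eq[of "f j" m] by (simp add: w_def)
      qed
      then have "\<phi> w = R \<union> f ` G" by (simp add: \<phi>_def)
      also have "f ` G = (\<Union>j\<in>G. A \<inter> block m j)" using f by auto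
      also have "R \<union> \<dots> = A" unfolding RA by auto
      finally show ?thesis using m by (auto simp: w_def W_def)
    qed
    have inOm: "\<phi> w \<in> Om" if "w \<in> W" for w
    proof -
      \<comment> \<open>\<open>A0\<close> is itself some \<open>\<phi> w0\<close>, so the common
        size \<open>card R + card G\<close> equals \<open>k\<close>.\<close>
      obtain w0 where "w0 \<in> W" "A0 = \<phi> w0" using surj by blast
      then have "card (\<phi> w) = k" using card\<phi> that A0' by metis
      moreover have "j * m + w j < n" if "j \<in> G" for j
        using inblock[OF \<open>w \<in> W\<close> that] block_subset[OF m Gb[OF that] b] by blast
      ultimately show ?thesis
        using finG A0' by (auto simp: Om_def nsets_def \<phi>_def R_def)
    qed
    have inj: "inj_on \<phi> W"
    proof (rule inj_onI)
      fix v w assume vw: "v \<in> W" "w \<in> W" "\<phi> v = \<phi> w"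
      have "v j = w j" if "j \<in> G" for j
        using trace[OF vw(1), of j] trace[OF vw(2), of j] vw(3) that by simp
      then show "v = w" using vw unfolding W_def by (intro PiE_ext) blast+
    qed
    have "\<phi> ` W = {A \<in> Om. cls A = cls A0}"
      using inOm cls surj by blast
    then have cardOm: "card {A \<in> Om. cls A = cls A0} = m ^ card G"
      using card_image[OF inj] finG by (simp add: W_def card_PiE)
    define F' where "F' = {w \<in> W. \<phi> w \<in> F}"
    have "\<phi> ` F' = {A \<in> F. cls A = cls A0}"
      using cls surj by (auto simp: F'_def)
    moreover have "inj_on \<phi> F'" using inj by (rule inj_on_subset) (auto simp: F'_def)
    ultimately have cardF: "card {A \<in> F. cls A = cls A0} = card F'"
      using card_image by metis
    have "m * card F' \<le> 2 * m ^ card G"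
    proof (rule card_words_le[OF finG _ _ d])
      show "F' \<subseteq> G \<rightarrow>\<^sub>E {..<m}" by (auto simp: F'_def W_def)
      show "m * d\<^sup>2 \<le> card G" using A0 by (simp add: Fb_def G_def)
      show "1 \<le> m" using m by simp
      fix v w i i' D
      assume vw: "v \<in> F'" "w \<in> F'" and D: "D \<subseteq> G" "card D = d" and i: "i < i'" "i' < m"
        and on: "\<And>j. j \<in> D \<Longrightarrow> v j = i \<and> w j = i'"
        and off: "\<And>j. j \<in> G - D \<Longrightarrow> v j = w j"
      have diff: "\<phi> p - \<phi> q = (\<lambda>j. j * m + r) ` D"
        if "p \<in> W" "q \<in> W" "r \<noteq> s" "\<And>j. j \<in> D \<Longrightarrow> p j = r \<and> q j = s"
          "\<And>j. j \<in> G - D \<Longrightarrow> p j = q j" for p q r s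
      proof (intro equalityI subsetI)
        fix x assume "x \<in> \<phi> p - \<phi> q"
        then obtain j where j: "j \<in> G" "x = j * m + p j" "x \<noteq> j * m + q j"
          unfolding \<phi>_def by blast
        then show "x \<in> (\<lambda>j. j * m + r) ` D" using that(4,5) by (cases "j \<in> D") auto
      next
        fix x assume "x \<in> (\<lambda>j. j * m + r) ` D"
        then obtain j where j: "j \<in> D" "x = j * m + r" by auto
        then have "x = j * m + p j" "x \<noteq> j * m + q j" "j \<in> G" using that(3,4) D by auto
        moreover from this have "\<phi> p \<inter> block m j = {x}" "\<phi> q \<inter> block m j = {j * m + q j}"
          using trace[OF that(1), of j] trace[OF that(2), of j] by auto
        ultimately show "x \<in> \<phi> p - \<phi> q" by blast
      qed
      have "pat (\<phi> v) (\<phi> w) = AP (card D)"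
      proof (rule pat_blocks)
        show "finite D" using D finG finite_subset by blast
        show "\<phi> v - \<phi> w = (\<lambda>j. j * m + i) ` D"
          by (rule diff[where s = i']) (use vw on off i in \<open>auto simp: F'_def\<close>)
        show "\<phi> w - \<phi> v = (\<lambda>j. j * m + i') ` D"
          by (rule diff[where s = i]) (use vw on off i in \<open>auto simp: F'_def\<close>)
      qed (use i in auto)
      then show False using free vw D by (auto simp: pattern_free_def F'_def)
    qed
    then show ?thesis by (simp add: cardF cardOm)
  qed
  have finFb: "finite Fb" using finF by (simp add: Fb_def)
  have FbOm: "Fb \<subseteq> Om" using FOm by (auto simp: Fb_def)
  have "m * card Fb = (\<Sum>c\<in>cls ` Fb. m * card {A \<in> Fb. cls A = c})"
    using sum.image_gen[OF finFb, of "\<lambda>_. 1::nat" cls] by (simp add: sum_distrib_left)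
  also have "\<dots> \<le> (\<Sum>c\<in>cls ` Fb. 2 * card {A \<in> Om. cls A = c})"
  proof (rule sum_mono)
    fix c assume "c \<in> cls ` Fb"
    then obtain A0 where A0: "A0 \<in> Fb" "c = cls A0" by blast
    have "card {A \<in> Fb. cls A = c} \<le> card {A \<in> F. cls A = c}"
      using finF by (intro card_mono) (auto simp: Fb_def)
    then have "m * card {A \<in> Fb. cls A = c} \<le> m * card {A \<in> F. cls A = c}" by simp
    also have "\<dots> \<le> 2 * card {A \<in> Om. cls A = c}" using class_le A0 by blast
    finally show "m * card {A \<in> Fb. cls A = c} \<le> 2 * card {A \<in> Om. cls A = c}" .
  qed
  also have "\<dots> \<le> (\<Sum>c\<in>cls ` Om. 2 * card {A \<in> Om. cls A = c})"
    using finOm FbOm by (intro sum_mono2) auto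
  also have "\<dots> = 2 * card Om"
    using sum.image_gen[OF finOm, of "\<lambda>_. 1::nat" cls] by (simp flip: sum_distrib_left)
  finally show ?thesis by (simp add: Fb_def Om_def card_nsets)
qed

subsection \<open>Averaging over subsets of size 2k\<close>

text \<open>The condition on \<open>k\<close> makes the two cases exhaustive: fewer than
  \<open>m * d^2\<close> good blocks is below the Chebyshev threshold
  \<open>b * m / (2 * 3^m)\<close>. The constant is 10 = 2 + 8.\<close>

lemma card_AP_free_central_le:
  assumes m: "m \<ge> 3" and d: "d \<ge> 1" and k: "2 * m * 3 ^ m * d\<^sup>2 \<le> k"
    and F: "F \<subseteq> nsets {..<2 * k} k" and free: "pattern_free (AP d) F"
  shows "m * card F \<le> 10 * ((2 * k) choose k)"
proof -
  define b where "b = 2 * k div m"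
  have d2: "d\<^sup>2 \<ge> 1" using d by simp
  have "2 * m * 3 ^ m * 1 \<le> 2 * m * 3 ^ m * d\<^sup>2" using d2 by (rule mult_left_mono) simp
  then have k1: "2 * m * 3 ^ m \<le> k" using k by linarith
  have "2 * m * 1 \<le> 2 * m * 3 ^ m" by (rule mult_left_mono) auto
  then have k2: "2 * m \<le> k" using k1 by linarith
  have "m < 3 ^ m" by (rule less_exp[THEN less_le_trans]) (simp add: power_mono)
  then have "m * m \<le> m * 3 ^ m" by simp
  then have k3: "m\<^sup>2 \<le> 2 * k" using k1 unfolding power2_eq_square by linarith
  have b1: "b * m \<le> 2 * k" by (simp add: b_def)
  have "2 * k < b * m + m" using m dividend_less_div_times[of m "2 * k"] by (simp add: b_def)
  \<comment> \<open>The incomplete last block loses fewer than \<open>m\<close> of the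
    \<open>2 * k\<close> points.\<close>
  then have b2: "k \<le> b * m" using k2 by linarith
  then have "m * 3 ^ m \<le> b * m" using k1 by linarith
  then have b3: "3 ^ m \<le> b" using m by (simp add: mult.commute)
  have finF: "finite F" using F by (rule finite_subset) (simp add: finite_imp_finite_nsets)
  let ?many = "{A \<in> F. m * d\<^sup>2 \<le> card (singletons m b A)}"
  let ?few = "{A \<in> nsets {..<2 * k} k. 2 * 3 ^ m * card (singletons m b A) < b * m}"
  have "F \<subseteq> ?many \<union> ?few"
  proof
    fix A assume A: "A \<in> F"
    show "A \<in> ?many \<union> ?few"
    proof (cases "m * d\<^sup>2 \<le> card (singletons m b A)")
      case False
      then have "2 * 3 ^ m * card (singletons m b A) < 2 * 3 ^ m * (m * d\<^sup>2)" by simp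
      also have "\<dots> = 2 * m * 3 ^ m * d\<^sup>2" by (simp only: mult_ac)
      also have "\<dots> \<le> b * m" using k b2 by (rule le_trans)
      finally show ?thesis using A F by auto
    qed (use A in simp)
  qed
  then have "card F \<le> card (?many \<union> ?few)"
    using finF by (intro card_mono) (auto simp: finite_imp_finite_nsets)
  also have "\<dots> \<le> card ?many + card ?few" by (rule card_Un_le)
  finally have "card F \<le> card ?many + card ?few" .
  then have "m * card F \<le> m * card ?many + m * card ?few"
    unfolding distrib_left[symmetric] by (rule mult_le_mono2)
  also have "m * card ?many \<le> 2 * ((2 * k) choose k)"
    using m d b1 F free by (intro card_many_singletons_le) auto
  also have "m * card ?few \<le> 8 * ((2 * k) choose k)"
    using m k2 k3 b1 b3 by (intro card_few_singletons_le) auto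
  finally show ?thesis by simp
qed

text \<open>Double counting of pairs \<open>A \<subseteq> W\<close> with \<open>W\<close> a
  \<open>2 * k\<close>-set; the binomial factors cancel by \<open>(n choose 2k) * (2k choose k) = (n
  choose k) * (n-k choose k)\<close>.\<close>

lemma card_AP_free_le:
  assumes m: "m \<ge> 3" and d: "d \<ge> 1" and k: "2 * m * 3 ^ m * d\<^sup>2 \<le> k"
    and U: "finite U" "2 * k \<le> card U"
    and F: "F \<subseteq> nsets U k" and free: "pattern_free (AP d) F"
  shows "m * card F \<le> 10 * (card U choose k)"
proof -
  define n where "n = card U"
  define \<W> where "\<W> = nsets U (2 * k)"
  have finF: "finite F" using F U(1) by (meson finite_imp_finite_nsets finite_subset)
  have fin\<W>: "finite \<W>" using U by (simp add: \<W>_def finite_imp_finite_nsets)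
  have restricted: "m * card {A \<in> F. A \<subseteq> W} \<le> 10 * ((2 * k) choose k)" if W: "W \<in> \<W>" for W
  proof -
    define e where "e = (\<lambda>i. sorted_list_of_set W ! i)"
    have cW: "finite W" "card W = 2 * k" using W by (auto simp: \<W>_def nsets_def)
    have mono: "strict_mono_on {..<2 * k} e"
      unfolding strict_mono_on_def e_def using cW
      by (auto intro!: sorted_wrt_nth_less[of "(<)"])
    then have inj: "inj_on e {..<2 * k}" by (rule strict_mono_on_imp_inj_on)
    have eW: "e ` {..<2 * k} = W"
      using cW nth_image[of "2 * k" "sorted_list_of_set W"] by (simp add: e_def lessThan_atLeast0)
    define F' where "F' = {A \<in> nsets {..<2 * k} k. e ` A \<in> F}"
    have "(`) e ` F' = {A \<in> F. A \<subseteq> W}"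
    proof (intro equalityI subsetI)
      fix B assume B: "B \<in> {A \<in> F. A \<subseteq> W}"
      then obtain A where A: "A \<subseteq> {..<2 * k}" "B = e ` A" using eW by (metis mem_Collect_eq subset_imageE)
      have "card A = card B" using A card_image[OF inj_on_subset[OF inj]] by metis
      also have "\<dots> = k" using B F by (auto simp: nsets_def)
      finally have "card A = k" .
      moreover have "finite A" using A(1) by (rule finite_subset) simp
      ultimately have "A \<in> F'" using A B by (simp add: F'_def nsets_def)
      then show "B \<in> (`) e ` F'" using A(2) by blast
    qed (use eW in \<open>auto simp: F'_def nsets_def\<close>)
    moreover have "inj_on ((`) e) F'"
      by (rule inj_on_subset[OF inj_on_image_Pow[OF inj]]) (auto simp: F'_def nsets_def)
    ultimately have "card {A \<in> F. A \<subseteq> W} = card F'" by (metis card_image)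
    moreover have "pattern_free (AP d) F'"
      unfolding pattern_free_def
    proof (intro ballI)
      fix A B assume AB: "A \<in> F'" "B \<in> F'"
      then have "pat (e ` A) (e ` B) = pat A B"
        by (intro pat_image[OF mono]) (auto simp: F'_def nsets_def)
      then show "pat A B \<noteq> AP d"
        using AB free by (auto simp: pattern_free_def F'_def)
    qed
    then have "m * card F' \<le> 10 * ((2 * k) choose k)"
      using m d k by (intro card_AP_free_central_le) (auto simp: F'_def)
    ultimately show ?thesis by simp
  qed
  have over: "card {W \<in> \<W>. A \<subseteq> W} = (n - k) choose k" if "A \<in> F" for A
  proof -
    have A: "A \<subseteq> U" "card A = k" using that F by (auto simp: nsets_def)
    have "{W \<in> \<W>. A \<subseteq> W} = {W \<in> nsets U (2 * k). W \<inter> A = A}" by (auto simp: \<W>_def)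
    then show ?thesis using card_nsets_trace[of U A A "2 * k"] A U by (simp add: n_def)
  qed
  have "card F * ((n - k) choose k) = (\<Sum>A\<in>F. card {W \<in> \<W>. A \<subseteq> W})"
    using over by simp
  also have "\<dots> = (\<Sum>W\<in>\<W>. card {A \<in> F. A \<subseteq> W})"
    by (rule sum_multicount_gen[OF finF fin\<W>]) simp
  finally have "m * (card F * ((n - k) choose k)) = (\<Sum>W\<in>\<W>. m * card {A \<in> F. A \<subseteq> W})"
    by (simp add: sum_distrib_left)
  also have "\<dots> \<le> (\<Sum>W\<in>\<W>. 10 * ((2 * k) choose k))"
    using restricted by (rule sum_mono)
  also have "\<dots> = 10 * ((n choose (2 * k)) * ((2 * k) choose k))"
    by (simp add: \<W>_def card_nsets U n_def)
  also have "(n choose (2 * k)) * ((2 * k) choose k) = (n choose k) * ((n - k) choose k)"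
    using choose_mult[of k "2 * k" n] U by (simp add: n_def)
  finally have "(m * card F) * ((n - k) choose k) \<le> (10 * (n choose k)) * ((n - k) choose k)"
    by (simp add: mult.assoc)
  moreover have "(n - k) choose k > 0" using U by (simp add: n_def zero_less_binomial)
  ultimately show ?thesis by (simp add: n_def)
qed

theorem theorem3:
  "\<exists>C::real. C > 0 \<and>
     (\<forall>d k n :: nat. d \<ge> 1 \<longrightarrow> 2 * k \<le> n \<longrightarrow> k > d\<^sup>2 \<longrightarrow>
        pattern_density n k (AP d) \<le> C / ln (real k / (real d)\<^sup>2))"
proof (intro exI[of _ 30] conjI allI impI)
  show "(0::real) < 30" by simp
next
  fix d k n :: nat
  assume d: "d \<ge> 1" and n: "2 * k \<le> n" and k: "k > d\<^sup>2"
  define r where "r = real k / (real d)\<^sup>2"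
  define L where "L = ln r"
  have "real (d\<^sup>2) < real k" using k by (simp only: of_nat_less_iff)
  then have r: "r > 1" using d by (simp add: r_def)
  then have L: "L > 0" by (simp add: L_def)
  let ?S = "{card F | F. F \<subseteq> nsets {1..n} k \<and> pattern_free (AP d) F}"
  have choose: "n choose k > 0" using n by (simp add: zero_less_binomial)
  have fin: "finite (nsets {1..n} k)" by (simp add: finite_imp_finite_nsets)
  have "?S \<subseteq> card ` Pow (nsets {1..n} k)" by auto
  then have "finite ?S" using fin by (meson finite_Pow_iff finite_imageI finite_subset)
  moreover have "?S \<noteq> {}" by (auto intro!: exI[of _ "{}"] simp: pattern_free_def)
  ultimately have "Max ?S \<in> ?S" by (rule Max_in)
  then obtain F where F: "F \<subseteq> nsets {1..n} k" "pattern_free (AP d) F" and Max: "Max ?S = card F"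
    by blast
  have dens: "pattern_density n k (AP d) = real (card F) / real (n choose k)"
    unfolding pattern_density_def Max ..
  show "pattern_density n k (AP d) \<le> 30 / ln (real k / (real d)\<^sup>2)"
  proof (cases "L < 6")
    \<comment> \<open>Here the trivial bound 1 suffices; the complementary case
      \<open>L >= 6\<close> is what guarantees \<open>m >= 3\<close>.\<close>
    case True
    have "card F \<le> n choose k" using card_mono[OF fin F(1)] by (simp add: card_nsets)
    then have "real (card F) / real (n choose k) \<le> 1" using choose by (simp add: field_simps)
    also have "1 \<le> 30 / L" using True L by (simp add: field_simps)
    finally show ?thesis by (simp add: dens L_def r_def)
  next
    case False
    define m where "m = nat \<lfloor>L / 2\<rfloor>"
    have "3 \<le> \<lfloor>L / 2\<rfloor>" using False by (simp add: le_floor_iff)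
    then have m3: "m \<ge> 3" unfolding m_def by linarith
    have mL: "real m \<le> L / 2" "L / 2 < real m + 1"
      using \<open>3 \<le> \<lfloor>L / 2\<rfloor>\<close> unfolding m_def by linarith+
    \<comment> \<open>The choice \<open>m = floor (L / 2)\<close> works because
      \<open>2 * m * 3^m <= 6^m\<close>, \<open>6 <= exp 2\<close> and
      \<open>2 * m <= L\<close>.\<close>
    have "2 * m \<le> 2 ^ m" using m3
    proof (induction m rule: dec_induct)
      case (step i)
      then show ?case using power_increasing[of 1 i "2::nat"] by simp
    qed simp
    then have "2 * m * 3 ^ m \<le> 2 ^ m * 3 ^ m" by (rule mult_right_mono) simp
    then have "2 * m * 3 ^ m \<le> 6 ^ m" by (simp flip: power_mult_distrib)
    then have "real (2 * m * 3 ^ m) \<le> real (6 ^ m)" by (simp only: of_nat_le_iff)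
    also have "real (6 ^ m) \<le> exp 2 ^ m"
    proof -
      have "(5 / 2 :: real) \<le> exp 1" using exp_lower_Taylor_quadratic[of 1] by simp
      then have "(5 / 2) * (5 / 2 :: real) \<le> exp 1 * exp 1" by (intro mult_mono) auto
      also have "\<dots> = exp 2" by (simp flip: exp_add)
      finally show ?thesis by (simp add: power_mono)
    qed
    also have "\<dots> = exp (2 * real m)" by (simp flip: exp_of_nat_mult add: mult.commute)
    also have "\<dots> \<le> exp L" using mL by simp
    also have "\<dots> = r" using r by (simp add: L_def)
    finally have "real (2 * m * 3 ^ m) * (real d)\<^sup>2 \<le> real k"
      using d by (simp add: r_def field_simps)
    then have "real (2 * m * 3 ^ m * d\<^sup>2) \<le> real k" by simp
    then have "2 * m * 3 ^ m * d\<^sup>2 \<le> k" by (simp only: of_nat_le_iff)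
    then have "m * card F \<le> 10 * (n choose k)"
      using card_AP_free_le[of m d k "{1..n}" F] m3 d n F by simp
    then have "real (m * card F) \<le> real (10 * (n choose k))" by (simp only: of_nat_le_iff)
    then have "real (card F) / real (n choose k) \<le> 10 / m"
      using choose m3 by (simp add: field_simps)
    \<comment> \<open>The 30 arises from \<open>L < 2 * m + 2 <= 3 * m\<close>.\<close>
    also have "\<dots> \<le> 30 / L" using mL False m3 by (simp add: field_simps)
    finally show ?thesis by (simp add: dens L_def r_def)
  qed
qed

end
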